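(* Let $k,a$ be positive integers, let $(P_{k,n})_{n\ge 0}$ be the $k$-Pell sequence and let $(G_{k,n})_{n\ge 0}$ be the Generalized $k$-Pell sequence with $G_{k,0}=G_{k,1}=a$. Then for every positive integer $i$ and every integer $n\ge i$, \[G_{k,n+1}=kG_{k,i}P_{k,n-i}+G_{k,i+1}P_{k,n+1-i}.\]
   Context: For a positive integer $k$, the $k$-Pell sequence is defined by $P_{k,0}=0$, $P_{k,1}=1$ and $P_{k,n}=2P_{k,n-1}+kP_{k,n-2}$ for $n\ge 2$. For positive integers $k,a$, the Generalized $k$-Pell sequence is defined by $G_{k,0}=G_{k,1}=a$ and $G_{k,n}=2G_{k,n-1}+kG_{k,n-2}$ for $n\ge 2$. *)

theory Defs
  imports Main
begin

fun k_pell :: "nat \<Rightarrow> nat \<Rightarrow> nat" where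
  "k_pell k 0 = 0"
| "k_pell k (Suc 0) = 1"
| "k_pell k (Suc (Suc n)) = 2 * k_pell k (Suc n) + k * k_pell k n"

fun gen_k_pell :: "nat \<Rightarrow> nat \<Rightarrow> nat \<Rightarrow> nat" where
  "gen_k_pell k a 0 = a"
| "gen_k_pell k a (Suc 0) = a"
| "gen_k_pell k a (Suc (Suc n)) = 2 * gen_k_pell k a (Suc n) + k * gen_k_pell k a n"

end

theory Submission
  imports Defs
begin

text \<open>Both sequences satisfy the same linear recurrence of order two, so the tail of the generalized
  sequence starting at index \<open>i\<close> is determined by its two entries at \<open>i\<close> and \<open>i + 1\<close>, and
  depends linearly on them. The coefficients are the solutions with initial values
  \<open>(1, 0)\<close> and \<open>(0, 1)\<close>, which are \<open>k\<close> times a shifted Pell sequence and the Pell sequence itself.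
  Writing \<open>n = i + m\<close> turns the identity into the addition law below.\<close>

text \<open>The induction on \<open>m\<close> moves the base point: the law at \<open>(i, m + 1)\<close> is the law at
  \<open>(i + 1, m)\<close> after expanding the entry at \<open>i + 2\<close> by the recurrence and regrouping the two
  multiples of the entry at \<open>i + 1\<close> into the next Pell number. Hence \<open>i\<close> must be arbitrary,
  and one induction hypothesis suffices although the recurrence has order two.\<close>

lemma gen_k_pell_add:
  "gen_k_pell k a (Suc (i + m)) =
    k * gen_k_pell k a i * k_pell k m + gen_k_pell k a (Suc i) * k_pell k (Suc m)"
proof (induction m arbitrary: i)
  case 0
  show ?case by simp
next
  case (Suc m)
  show ?case using Suc.IH[of "Suc i"] by (simp add: algebra_simps)
qed

theorem theorem4p10:
  fixes k a i n :: nat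
  assumes "k > 0" and "a > 0" and "i > 0" and "n \<ge> i"
  shows "gen_k_pell k a (n + 1) =
    k * gen_k_pell k a i * k_pell k (n - i) + gen_k_pell k a (i + 1) * k_pell k (n + 1 - i)"
  using gen_k_pell_add[of k a i "n - i"] \<open>n \<ge> i\<close> by (simp add: Suc_diff_le)

end
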